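(* Let $n\ge 3$. The group $G_n=\{\sigma_{\tau,n}:\gcd(\tau,n)=1\}$ acts on the set $C_n$ of all cubic MRS functions in $n$ variables by $f=(1,j,k)\mapsto \sigma_{\tau,n}((1,j,k))$, where $(1,j,k)$ is the unique representation of $f$ in $D_n$ and $\sigma_{\tau,n}$ is applied to each monomial by $x_ax_bx_c\mapsto x_{\sigma_{\tau,n}(a)}x_{\sigma_{\tau,n}(b)}x_{\sigma_{\tau,n}(c)}$. The orbits of this group action are exactly the affine equivalence classes of $C_n$ under permutations which preserve rotation symmetry.
   Context: A Boolean function in $n$ variables is written in algebraic normal form as a polynomial over $GF(2)$ in $x_1,\dots,x_n$; indices are read modulo $n$ in $\{1,\dots,n\}$. For an integer $a$, $a \text{ Mod } n$ denotes the unique $b\in\{1,\dots,n\}$ with $b\equiv a \pmod n$. A function is rotation symmetric if its algebraic normal form is unchanged by every cyclic shift of the variables. For pairwise distinct $1,j,k\in\{1,\dots,n\}$, the cubic monomial rotation symmetric (MRS) function $(1,j,k)$ is the sum of the distinct monomials among $x_{1+t}x_{j+t}x_{k+t}$, $t=0,\dots,n-1$ (there are $n$ of them, except $n/3$ when $3\mid n$ and $\{j,k\}=\{n/3+1,2n/3+1\}$). Several triples can represent the same function; $D_n$ is the set of triples $(1,j,k)$ with $1<j<k\le n$ obtained by choosing for each cubic MRS function its representation with least $j$ and, given that, least $k$. A permutation $\sigma$ of $\{1,\dots,n\}$ acts on functions by replacing each $x_i$ by $x_{\sigma(i)}$. It preserves rotation symmetry if $\sigma(f)$ is rotation symmetric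 for every cubic MRS function $f$ in $n$ variables. Two functions $f,g\in C_n$ are affine equivalent under permutations which preserve rotation symmetry if $\sigma(f)=g$ for some such permutation $\sigma$. For $\gcd(\tau,n)=1$, $\sigma_{\tau,n}$ is the permutation $\sigma_{\tau,n}(i)=(i-1)\tau+1 \text{ Mod } n$, $1\le i\le n$; $G_n$ is a group under composition. *)

theory Defs
  imports "HOL-Library.Poly_Mapping" "HOL-Library.Z2" "HOL-Algebra.Sym_Groups"
    "HOL-Algebra.Group_Action" "HOL-Number_Theory.Cong"
begin

text \<open>
  Polynomials over GF(2) in variables indexed by natural numbers, as finitely supported maps
  from exponent vectors to coefficients. The algebraic normal form of a Boolean function in
  \<open>n\<close> variables is such a polynomial, squarefree and involving only \<open>x\<^sub>1, \<dots>, x\<^sub>n\<close>.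
\<close>

type_synonym gf2_poly = "(nat \<Rightarrow>\<^sub>0 nat) \<Rightarrow>\<^sub>0 bit"

definition var :: "nat \<Rightarrow> gf2_poly" where
  "var i = Poly_Mapping.single (Poly_Mapping.single i 1) 1"

definition rename_vars :: "(nat \<Rightarrow> nat) \<Rightarrow> gf2_poly \<Rightarrow> gf2_poly" where
  "rename_vars \<sigma> f =
     (\<Sum>m \<in> Poly_Mapping.keys f. Poly_Mapping.single 0 (Poly_Mapping.lookup f m) *
        (\<Prod>i \<in> Poly_Mapping.keys m. var (\<sigma> i) ^ Poly_Mapping.lookup m i))"

text \<open>The representative of \<open>a\<close> modulo \<open>n\<close> in \<open>{1..n}\<close> (not in \<open>{0..<n}\<close>).\<close>

definition cmod :: "int \<Rightarrow> nat \<Rightarrow> nat" where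
  "cmod a n = nat ((a - 1) mod int n) + 1"

lemma cmod_unique:
  assumes "n > 0"
  shows "b = cmod a n \<longleftrightarrow> b \<in> {1..n} \<and> [int b = a] (mod int n)"
proof
  assume b: "b = cmod a n"
  have r: "0 \<le> (a - 1) mod int n" "(a - 1) mod int n < int n"
    using assms by auto
  have "int b = (a - 1) mod int n + 1"
    using b r by (simp add: cmod_def)
  moreover have "((a - 1) mod int n + 1) mod int n = a mod int n"
    by (simp add: mod_simps)
  ultimately show "b \<in> {1..n} \<and> [int b = a] (mod int n)"
    using r by (auto simp: cong_def)
next
  assume b: "b \<in> {1..n} \<and> [int b = a] (mod int n)"
  then have "(int b - 1) mod int n = (a - 1) mod int n"
    by (metis cong_def mod_diff_left_eq)
  moreover have "(int b - 1) mod int n = int b - 1"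
    using b by (intro mod_pos_pos_trivial) auto
  ultimately show "b = cmod a n"
    using b by (auto simp: cmod_def)
qed

text \<open>The cyclic shift \<open>x\<^sub>i \<mapsto> x\<^sub>i\<^sub>+\<^sub>t\<close> of the variables \<open>x\<^sub>1, \<dots>, x\<^sub>n\<close>.\<close>

definition shift :: "nat \<Rightarrow> nat \<Rightarrow> nat \<Rightarrow> nat" where
  "shift n t i = (if i \<in> {1..n} then cmod (int i + int t) n else i)"

definition rotation_symmetric :: "nat \<Rightarrow> gf2_poly \<Rightarrow> bool" where
  "rotation_symmetric n f \<longleftrightarrow> (\<forall>t<n. rename_vars (shift n t) f = f)"

text \<open>
  The outer sum runs over a set of monomials, so that monomials repeated for different \<open>t\<close>
  are counted once.
\<close>

fun mrs :: "nat \<Rightarrow> nat \<times> nat \<times> nat \<Rightarrow> gf2_poly" where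
  "mrs n (i, j, k) =
     \<Sum> {var (cmod (int i + int t) n) * var (cmod (int j + int t) n) * var (cmod (int k + int t) n)
         | t. t < n}"

definition cubic_mrs :: "nat \<Rightarrow> gf2_poly set" where
  "cubic_mrs n = {mrs n (1, j, k) | j k. j \<in> {1..n} \<and> k \<in> {1..n} \<and> distinct [1, j, k]}"

definition D :: "nat \<Rightarrow> (nat \<times> nat \<times> nat) set" where
  "D n = {(1, j, k) | j k. 1 < j \<and> j < k \<and> k \<le> n \<and>
     (\<forall>j' k'. 1 < j' \<and> j' < k' \<and> k' \<le> n \<and> mrs n (1, j', k') = mrs n (1, j, k) \<longrightarrow>
        j < j' \<or> j = j' \<and> k \<le> k')}"

lemma mrs_swap: "mrs n (i, j, k) = mrs n (i, k, j)"
  by (simp add: ac_simps)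

lemma D_unique_representation:
  assumes f: "f \<in> cubic_mrs n"
  shows "\<exists>!d. d \<in> D n \<and> f = mrs n d"
proof -
  let ?P = "\<lambda>j k. 1 < j \<and> j < k \<and> k \<le> n \<and> mrs n (1, j, k) = f"
  have "\<exists>j k. ?P j k"
  proof -
    from f obtain j k where jk: "f = mrs n (1, j, k)" "j \<in> {1..n}" "k \<in> {1..n}"
      "distinct [1, j, k]"
      unfolding cubic_mrs_def by blast
    show ?thesis
    proof (cases "j < k")
      case True
      with jk have "?P j k" by auto
      then show ?thesis by blast
    next
      case False
      with jk have "?P k j" using mrs_swap[of n 1 j k] by auto
      then show ?thesis by blast
    qed
  qed
  then have ex: "\<exists>j. \<exists>k. ?P j k" .
  define j where "j = (LEAST j. \<exists>k. ?P j k)"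
  have exk: "\<exists>k. ?P j k"
    unfolding j_def by (rule LeastI_ex[OF ex])
  define k where "k = (LEAST k. ?P j k)"
  have jk: "?P j k"
    unfolding k_def by (rule LeastI_ex[OF exk])
  have min: "j < j' \<or> j = j' \<and> k \<le> k'" if "?P j' k'" for j' k'
  proof -
    have "j \<le> j'"
      unfolding j_def by (rule Least_le) (use that in blast)
    moreover have "k \<le> k'" if "j = j'"
      unfolding k_def by (rule Least_le) (use \<open>?P j' k'\<close> that in blast)
    ultimately show ?thesis by linarith
  qed
  have "(1, j, k) \<in> D n"
    unfolding D_def using jk min by blast
  moreover have "d = (1, j, k)" if d: "d \<in> D n" "f = mrs n d" for d
  proof -
    from d(1) obtain j' k' where d': "d = (1, j', k')" "1 < j'" "j' < k'" "k' \<le> n"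
      "\<And>a b. 1 < a \<and> a < b \<and> b \<le> n \<and> mrs n (1, a, b) = mrs n (1, j', k') \<Longrightarrow>
         j' < a \<or> j' = a \<and> k' \<le> b"
      unfolding D_def by blast
    have "?P j' k'" using d(2) d' by metis
    from min[OF this] d'(5)[of j k] jk d(2) d'(1) show ?thesis
      by (metis le_antisym less_asym less_irrefl)
  qed
  ultimately show ?thesis using jk by metis
qed

text \<open>Like \<^const>\<open>shift\<close>, extended by the identity outside \<open>{1..n}\<close>.\<close>

definition sigma :: "int \<Rightarrow> nat \<Rightarrow> nat \<Rightarrow> nat" where
  "sigma \<tau> n i = (if i \<in> {1..n} then cmod ((int i - 1) * \<tau> + 1) n else i)"

definition G :: "nat \<Rightarrow> (nat \<Rightarrow> nat) monoid" where
  "G n = (sym_group n)\<lparr>carrier := {sigma \<tau> n | \<tau>. gcd \<tau> (int n) = 1}\<rparr>"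

text \<open>Maps on a set acted upon are extensional in \<^locale>\<open>group_action\<close>, hence the restriction.\<close>

definition mrs_action :: "nat \<Rightarrow> (nat \<Rightarrow> nat) \<Rightarrow> gf2_poly \<Rightarrow> gf2_poly" where
  "mrs_action n \<sigma> =
     (\<lambda>f \<in> cubic_mrs n. rename_vars \<sigma> (mrs n (THE d. d \<in> D n \<and> f = mrs n d)))"

definition preserves_rotation_symmetry :: "nat \<Rightarrow> (nat \<Rightarrow> nat) \<Rightarrow> bool" where
  "preserves_rotation_symmetry n \<sigma> \<longleftrightarrow>
     \<sigma> permutes {1..n} \<and> (\<forall>f \<in> cubic_mrs n. rotation_symmetric n (rename_vars \<sigma> f))"

definition affine_equiv :: "nat \<Rightarrow> (gf2_poly \<times> gf2_poly) set" where
  "affine_equiv n =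
     {(f, g). f \<in> cubic_mrs n \<and> g \<in> cubic_mrs n \<and>
        (\<exists>\<sigma>. preserves_rotation_symmetry n \<sigma> \<and> rename_vars \<sigma> f = g)}"

end

theory Submission
  imports Defs
begin

text \<open>
  A squarefree polynomial is a finite family of finite sets of indices, and cubic MRS functions
  are the orbits of 3-element subsets of \<open>\<int>/n\<close> under translation. A permutation \<open>\<sigma>\<close> preserves
  rotation symmetry only if \<open>\<pi> = \<sigma>\<^sup>-\<^sup>1 \<circ> (+1) \<circ> \<sigma>\<close> maps every 3-element set to a translate of
  itself. For \<open>n \<ge> 5\<close>, applying this to the sets \<open>{a, a+1, a+2}\<close> shows that \<open>\<pi>\<close> preserves adjacency
  in the cycle \<open>\<int>/n\<close>, so \<open>\<pi>\<close> is a translation or a reflection; for \<open>n \<ge> 6\<close> a reflection does not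
  map \<open>{0, 1, 3}\<close> to a translate of itself. So \<open>\<sigma>\<close> is
  affine and differs from some \<open>\<sigma>\<^sub>\<tau>\<close> by a translation, which acts trivially on MRS functions.
  For \<open>n \<le> 5\<close> the group already acts transitively on the cubic MRS functions.
\<close>

section \<open>Squarefree polynomials as families of index sets\<close>

definition exponent_of :: "nat set \<Rightarrow> nat \<Rightarrow>\<^sub>0 nat" where
  "exponent_of S = (\<Sum>i\<in>S. Poly_Mapping.single i 1)"

text \<open>Monomials are handled as index sets, so that equality of polynomials becomes equality of
  families. Sums and products over infinite sets default to 0 and 1, whence the finiteness
  hypotheses in the lemmas below.\<close>

definition poly_of :: "nat set set \<Rightarrow> gf2_poly" where
  "poly_of F = (\<Sum>S\<in>F. \<Prod>i\<in>S. var i)"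

lemma lookup_exponent_of:
  assumes "finite S"
  shows "Poly_Mapping.lookup (exponent_of S) i = (if i \<in> S then 1 else 0)"
  using assms by (simp add: exponent_of_def lookup_sum lookup_single when_def)

lemma keys_exponent_of: "finite S \<Longrightarrow> Poly_Mapping.keys (exponent_of S) = S"
  by (auto simp: in_keys_iff lookup_exponent_of split: if_splits)

lemma inj_on_exponent_of:
  assumes "\<And>S. S \<in> F \<Longrightarrow> finite S"
  shows "inj_on exponent_of F"
  using assms by (metis inj_onI keys_exponent_of)

lemma prod_var:
  assumes "finite S"
  shows "(\<Prod>i\<in>S. var i) = Poly_Mapping.single (exponent_of S) 1"
  using assms
  by (induction S rule: finite_induct) (auto simp: exponent_of_def var_def mult_single)

lemma lookup_poly_of:
  assumes "finite F" "\<And>S. S \<in> F \<Longrightarrow> finite S"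
  shows "Poly_Mapping.lookup (poly_of F) m = (if m \<in> exponent_of ` F then 1 else 0)"
proof -
  have "poly_of F = (\<Sum>S\<in>F. Poly_Mapping.single (exponent_of S) 1)"
    unfolding poly_of_def using assms by (intro sum.cong) (auto simp: prod_var)
  also have "\<dots> = (\<Sum>k\<in>exponent_of ` F. Poly_Mapping.single k 1)"
    using inj_on_exponent_of[OF assms(2)] by (simp add: sum.reindex)
  finally show ?thesis
    using assms(1) by (simp add: lookup_sum lookup_single when_def)
qed

lemma keys_poly_of:
  assumes "finite F" "\<And>S. S \<in> F \<Longrightarrow> finite S"
  shows "Poly_Mapping.keys (poly_of F) = exponent_of ` F"
  by (intro equalityI subsetI) (simp_all add: in_keys_iff lookup_poly_of[OF assms] split: if_splits)

text \<open>The support of the polynomial is the set of exponent vectors of the family, and a finite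
  index set is recovered as the support of its exponent vector.\<close>

lemma poly_of_inj:
  assumes "finite F" "\<And>S. S \<in> F \<Longrightarrow> finite S" "finite F'" "\<And>S. S \<in> F' \<Longrightarrow> finite S"
    and "poly_of F = poly_of F'"
  shows "F = F'"
proof -
  have "exponent_of ` F = exponent_of ` F'"
    using assms keys_poly_of by metis
  moreover have "inj_on exponent_of (F \<union> F')"
    using assms by (intro inj_on_exponent_of) auto
  ultimately show ?thesis
    by (simp add: inj_on_image_eq_iff)
qed

text \<open>An injective renaming keeps each monomial squarefree and keeps distinct monomials
  distinct, so no cancellation over GF(2) occurs.\<close>

lemma rename_vars_poly_of:
  assumes F: "finite F" "\<And>S. S \<in> F \<Longrightarrow> finite S" and \<sigma>: "inj \<sigma>"
  shows "rename_vars \<sigma> (poly_of F) = poly_of ((`) \<sigma> ` F)"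
proof -
  have "rename_vars \<sigma> (poly_of F) =
      (\<Sum>m\<in>exponent_of ` F. \<Prod>i\<in>Poly_Mapping.keys m. var (\<sigma> i) ^ Poly_Mapping.lookup m i)"
    unfolding rename_vars_def using F
    by (intro sum.cong) (simp_all add: keys_poly_of lookup_poly_of)
  also have "\<dots> = (\<Sum>S\<in>F. \<Prod>i\<in>S. var (\<sigma> i))"
    using F inj_on_exponent_of[of F]
    by (subst sum.reindex) (auto simp: keys_exponent_of lookup_exponent_of intro!: sum.cong prod.cong)
  also have "\<dots> = (\<Sum>S\<in>F. \<Prod>i\<in>\<sigma> ` S. var i)"
    using \<sigma> by (intro sum.cong) (auto simp: prod.reindex inj_on_def)
  also have "\<dots> = poly_of ((`) \<sigma> ` F)"
    unfolding poly_of_def using \<sigma>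
    by (subst sum.reindex) (auto simp: inj_on_def inj_image_eq_iff)
  finally show ?thesis .
qed

lemma image_image_sets: "(`) f ` (`) g ` A = (`) (f \<circ> g) ` A"
  by (simp add: image_image comp_def)

section \<open>Arithmetic modulo \<open>n\<close> and the permutations \<open>shift\<close> and
  \<open>sigma\<close>\<close>

lemma cmod_eq_iff:
  assumes "0 < n"
  shows "cmod a n = cmod b n \<longleftrightarrow> [a = b] (mod int n)"
  using cmod_unique[OF assms, of "cmod a n" a] cmod_unique[OF assms, of "cmod a n" b]
  by (metis cong_sym cong_trans)

lemma cmod_mem: "0 < n \<Longrightarrow> cmod a n \<in> {1..n}"
  using cmod_unique by blast

lemma cmod_cong: "0 < n \<Longrightarrow> [int (cmod a n) = a] (mod int n)"
  using cmod_unique by blast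

lemma cmod_of_nat: "i \<in> {1..n} \<Longrightarrow> cmod (int i) n = i"
  using cmod_unique[of n i "int i"] by auto

lemma shift_cmod: "0 < n \<Longrightarrow> shift n t (cmod a n) = cmod (a + int t) n"
  using cmod_mem[of n a] by (auto simp: shift_def cmod_eq_iff cmod_cong intro: cong_add)

lemma sigma_cmod: "0 < n \<Longrightarrow> sigma \<tau> n (cmod a n) = cmod ((a - 1) * \<tau> + 1) n"
  using cmod_mem[of n a]
  by (auto simp: sigma_def cmod_eq_iff cmod_cong intro!: cong_add cong_mult cong_diff)

text \<open>Every index in \<open>{1..n}\<close> has the form \<open>cmod a n\<close>, so index maps
  can be compared by computing with arbitrary integers \<open>a\<close>, free of range
  conditions.\<close>

lemma eq_on_cmodI:
  assumes "0 < n" "\<And>a. f (cmod a n) = g (cmod a n)" "\<And>i. i \<notin> {1..n} \<Longrightarrow> f i = g i"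
  shows "f = g"
  using assms cmod_of_nat by (metis ext)

lemma shift_0: "0 < n \<Longrightarrow> shift n 0 = id"
  by (rule eq_on_cmodI) (auto simp: shift_cmod, auto simp: shift_def)

lemma shift_shift: "0 < n \<Longrightarrow> shift n s \<circ> shift n t = shift n (s + t)"
  by (rule eq_on_cmodI) (auto simp: shift_cmod algebra_simps, auto simp: shift_def)

lemma shift_shift_image: "0 < n \<Longrightarrow> shift n s ` shift n t ` S = shift n (s + t) ` S"
  by (simp only: image_comp shift_shift)

lemma shift_cong:
  assumes "0 < n" "[int s = int t] (mod int n)"
  shows "shift n s = shift n t"
proof (rule eq_on_cmodI[OF assms(1)])
  show "shift n s (cmod a n) = shift n t (cmod a n)" for a
    using assms cong_add[OF cong_refl assms(2)] by (simp add: shift_cmod cmod_eq_iff)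
qed (auto simp: shift_def)

lemma shift_mult_n: "0 < n \<Longrightarrow> shift n (n * t) = id"
  using shift_cong[of n "n * t" 0] by (simp add: shift_0 cong_def)

lemma sigma_1: "0 < n \<Longrightarrow> sigma 1 n = id"
  by (rule eq_on_cmodI) (auto simp: sigma_cmod, auto simp: sigma_def)

lemma sigma_sigma: "0 < n \<Longrightarrow> sigma \<tau> n \<circ> sigma \<upsilon> n = sigma (\<tau> * \<upsilon>) n"
  by (rule eq_on_cmodI) (auto simp: sigma_cmod algebra_simps, auto simp: sigma_def)

lemma sigma_cong:
  assumes "0 < n" "[\<tau> = \<upsilon>] (mod int n)"
  shows "sigma \<tau> n = sigma \<upsilon> n"
proof (rule eq_on_cmodI[OF assms(1)])
  show "sigma \<tau> n (cmod a n) = sigma \<upsilon> n (cmod a n)" for a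
    using assms(1) cong_add[OF cong_mult[OF cong_refl assms(2)] cong_refl]
    by (simp add: sigma_cmod cmod_eq_iff)
qed (auto simp: sigma_def)

text \<open>An affine map of slope \<tau> turns translation by \<open>t\<close> into translation by
  \<tau> times \<open>t\<close>. Since \<tau> may be negative, the amount is reduced modulo
  \<open>n\<close> before conversion to a natural number.\<close>

lemma sigma_shift:
  assumes "0 < n"
  shows "sigma \<tau> n \<circ> shift n t = shift n (nat (\<tau> * int t mod int n)) \<circ> sigma \<tau> n"
proof (rule eq_on_cmodI[OF assms])
  fix a
  have "[(a + int t - 1) * \<tau> + 1 = (a - 1) * \<tau> + 1 + \<tau> * int t mod int n] (mod int n)"
    using cong_add[OF cong_refl, of "\<tau> * int t" "\<tau> * int t mod int n" _ "(a - 1) * \<tau> + 1"]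
    by (simp add: cong_mod_right algebra_simps)
  then show "(sigma \<tau> n \<circ> shift n t) (cmod a n) =
      (shift n (nat (\<tau> * int t mod int n)) \<circ> sigma \<tau> n) (cmod a n)"
    using assms by (simp add: shift_cmod sigma_cmod cmod_eq_iff)
qed (auto simp: shift_def sigma_def)

lemma sigma_inverse:
  assumes "0 < n" "gcd \<tau> (int n) = 1"
  obtains \<upsilon> where "gcd \<upsilon> (int n) = 1" "[\<tau> * \<upsilon> = 1] (mod int n)"
    "sigma \<upsilon> n \<circ> sigma \<tau> n = id" "sigma \<tau> n \<circ> sigma \<upsilon> n = id"
proof -
  obtain \<upsilon> where \<upsilon>: "[\<tau> * \<upsilon> = 1] (mod int n)"
    using assms(2) by (metis coprime_iff_gcd_eq_1 cong_solve_coprime_int)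
  then have "coprime \<upsilon> (int n)"
    by (metis coprime_iff_invertible_int mult.commute)
  then have "gcd \<upsilon> (int n) = 1"
    by simp
  moreover have "sigma (\<tau> * \<upsilon>) n = id" "sigma (\<upsilon> * \<tau>) n = id"
    using sigma_cong[OF assms(1) \<upsilon>] sigma_1[OF assms(1)] by (auto simp: mult.commute)
  ultimately show ?thesis
    using that \<upsilon> sigma_sigma[OF assms(1)] by simp
qed

lemma permutesI_inverse:
  assumes "\<And>i. i \<notin> S \<Longrightarrow> f i = i" "g \<circ> f = id" "f \<circ> g = id"
  shows "f permutes S"
  using assms unfolding permutes_def by (metis comp_apply id_apply)

lemma sigma_permutes:
  assumes "0 < n" "gcd \<tau> (int n) = 1"
  shows "sigma \<tau> n permutes {1..n}"
proof -
  obtain \<upsilon> where "sigma \<upsilon> n \<circ> sigma \<tau> n = id" "sigma \<tau> n \<circ> sigma \<upsilon> n = id"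
    using sigma_inverse[OF assms] by blast
  then show ?thesis
    by (intro permutesI_inverse) (auto simp: sigma_def)
qed

text \<open>Translation amounts are natural numbers; \<open>(n - 1) * t\<close> serves as the
  negative of \<open>t\<close> modulo \<open>n\<close>.\<close>

lemma shift_inverse:
  assumes "0 < n"
  shows "shift n ((n - 1) * t) \<circ> shift n t = id" "shift n t \<circ> shift n ((n - 1) * t) = id"
proof -
  have "(n - 1) * t + t = n * t" 
    using assms by (simp add: algebra_simps)
  then show "shift n ((n - 1) * t) \<circ> shift n t = id" "shift n t \<circ> shift n ((n - 1) * t) = id"
    using assms by (auto simp: shift_shift shift_mult_n add.commute)
qed

lemma shift_permutes: "0 < n \<Longrightarrow> shift n t permutes {1..n}"
  using shift_inverse[of n t] by (intro permutesI_inverse) (auto simp: shift_def)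

section \<open>Cubic MRS functions as translation orbits of triples\<close>

definition rot_orbit :: "nat \<Rightarrow> nat set \<Rightarrow> nat set set" where
  "rot_orbit n S = range (\<lambda>t. shift n t ` S)"

definition triples :: "nat \<Rightarrow> nat set set" where
  "triples n = {S. S \<subseteq> {1..n} \<and> card S = 3}"

text \<open>The range over all natural numbers makes composition of shifts plain addition; the
  bounded form gives finiteness and matches the index range in \<open>mrs\<close>.\<close>

lemma rot_orbit_bounded:
  assumes "0 < n"
  shows "rot_orbit n S = (\<lambda>t. shift n t ` S) ` {..<n}"
proof -
  have "shift n t ` S = shift n (t mod n) ` S" "t mod n < n" for t
    using assms shift_cong[of n t "t mod n"] by (auto simp: cong_def zmod_int)
  then show ?thesis
    unfolding rot_orbit_def by (auto simp: image_iff) (metis lessThan_iff)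
qed

lemma permutes_triples:
  assumes "\<sigma> permutes {1..n}" "S \<in> triples n"
  shows "\<sigma> ` S \<in> triples n"
  using assms card_image[OF inj_on_subset[OF permutes_inj[OF assms(1)]], of S]
    permutes_in_image[OF assms(1)] unfolding triples_def by auto

lemma finite_triples: "S \<in> triples n \<Longrightarrow> finite S"
  unfolding triples_def using finite_subset by blast

lemma rot_orbit_triples: "0 < n \<Longrightarrow> S \<in> triples n \<Longrightarrow> rot_orbit n S \<subseteq> triples n"
  unfolding rot_orbit_def using permutes_triples[OF shift_permutes] by blast

lemma finite_rot_orbit: "0 < n \<Longrightarrow> finite (rot_orbit n S)"
  by (simp add: rot_orbit_bounded)

lemma mem_rot_orbit: "0 < n \<Longrightarrow> S \<in> rot_orbit n S"
  unfolding rot_orbit_def by (rule range_eqI[of _ _ 0]) (simp add: shift_0)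

lemma rot_orbit_shift:
  assumes "0 < n"
  shows "rot_orbit n (shift n s ` S) = rot_orbit n S"
proof -
  \<comment> \<open>One inclusion for all \<open>s\<close> and \<open>S\<close> suffices: applied to
    the inverse shift, it yields the other.\<close>
  have *: "rot_orbit n (shift n s ` S) \<subseteq> rot_orbit n S" for s S
    unfolding rot_orbit_def
    by (intro image_subsetI range_eqI, rule shift_shift_image[OF assms])
  have "S = shift n ((n - 1) * s) ` shift n s ` S"
    using shift_inverse(1)[OF assms, of s] by (simp only: image_comp image_id id_apply)
  then show ?thesis
    using * by (metis subset_antisym)
qed

lemma shift_image_rot_orbit:
  assumes "0 < n"
  shows "(`) (shift n s) ` rot_orbit n S = rot_orbit n S"
proof -
  have "(`) (shift n s) ` rot_orbit n S = rot_orbit n (shift n s ` S)"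
    unfolding rot_orbit_def image_image[of "(`) (shift n s)"]
    by (simp only: shift_shift_image[OF assms] add.commute)
  then show ?thesis
    by (simp add: rot_orbit_shift[OF assms])
qed

text \<open>By \<open>sigma_shift\<close>, translates of \<open>S\<close> go to translates of the
  image of \<open>S\<close>. The reverse inclusion is the same fact for the inverse slope, carried
  back by \<open>sigma \<tau> n\<close>.\<close>

lemma sigma_image_rot_orbit:
  assumes "0 < n" "gcd \<tau> (int n) = 1"
  shows "(`) (sigma \<tau> n) ` rot_orbit n S = rot_orbit n (sigma \<tau> n ` S)"
proof -
  have *: "(`) (sigma \<tau> n) ` rot_orbit n S \<subseteq> rot_orbit n (sigma \<tau> n ` S)" for \<tau> S
  proof -
    have "sigma \<tau> n ` shift n t ` S = shift n (nat (\<tau> * int t mod int n)) ` sigma \<tau> n ` S" for t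
      by (simp only: image_comp sigma_shift[OF assms(1)])
    then show ?thesis
      unfolding rot_orbit_def image_image[of "(`) (sigma \<tau> n)"] by (intro image_subsetI range_eqI)
  qed
  obtain \<upsilon> where \<upsilon>: "sigma \<upsilon> n \<circ> sigma \<tau> n = id" "sigma \<tau> n \<circ> sigma \<upsilon> n = id"
    using sigma_inverse[OF assms] by blast
  have "(`) (sigma \<upsilon> n) ` rot_orbit n (sigma \<tau> n ` S) \<subseteq> rot_orbit n S"
    using *[of \<upsilon> "sigma \<tau> n ` S"] \<upsilon>(1) by (simp only: image_comp image_id id_apply)
  then have "(`) (sigma \<tau> n) ` (`) (sigma \<upsilon> n) ` rot_orbit n (sigma \<tau> n ` S)
      \<subseteq> (`) (sigma \<tau> n) ` rot_orbit n S"
    by blast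
  moreover have "(`) (sigma \<tau> n) ` (`) (sigma \<upsilon> n) ` A = A" for A
    using \<upsilon>(2) by (simp add: image_image_sets)
  ultimately show ?thesis
    using *[of \<tau> S] by auto
qed

lemma rename_vars_rot_orbit:
  assumes "0 < n" "S \<in> triples n" "inj \<sigma>"
  shows "rename_vars \<sigma> (poly_of (rot_orbit n S)) = poly_of ((`) \<sigma> ` rot_orbit n S)"
  using assms finite_triples rot_orbit_triples
  by (intro rename_vars_poly_of finite_rot_orbit) blast+

text \<open>The set comprehension in \<open>mrs\<close> counts repeated monomials once, just as a
  family of sets does. The two sums agree because distinct index sets give distinct
  monomials.\<close>

lemma mrs_eq_poly_of:
  assumes "0 < n" "{i, j, k} \<in> triples n"
  shows "mrs n (i, j, k) = poly_of (rot_orbit n {i, j, k})"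
proof -
  have ijk: "i \<in> {1..n}" "j \<in> {1..n}" "k \<in> {1..n}" "distinct [i, j, k]"
    using assms(2) by (auto simp: triples_def card_insert_if split: if_splits)
  have "var (cmod (int i + int t) n) * var (cmod (int j + int t) n) * var (cmod (int k + int t) n)
      = (\<Prod>i\<in>shift n t ` {i, j, k}. var i)" for t
  proof -
    have inj: "inj (shift n t)"
      using shift_permutes[OF assms(1)] by (rule permutes_inj)
    have "shift n t i \<noteq> shift n t j" "shift n t i \<noteq> shift n t k" "shift n t j \<noteq> shift n t k"
      using ijk(4) by (auto simp: inj_eq[OF inj])
    then show ?thesis
      using ijk(1-3) by (simp add: shift_def mult.assoc)
  qed
  then have "mrs n (i, j, k) = \<Sum> ((\<lambda>S. \<Prod>i\<in>S. var i) ` rot_orbit n {i, j, k})"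
    unfolding rot_orbit_bounded[OF assms(1)] mrs.simps
    by (intro arg_cong[of _ _ "\<lambda>A. \<Sum> A"]) auto
  also have "\<dots> = poly_of (rot_orbit n {i, j, k})"
  proof -
    have fin: "finite S" if "S \<in> rot_orbit n {i, j, k}" for S
      using that rot_orbit_triples[OF assms] finite_triples by blast
    have "inj_on (\<lambda>S. \<Prod>i\<in>S. var i) (rot_orbit n {i, j, k})"
    proof (rule inj_onI)
      fix S T assume "S \<in> rot_orbit n {i, j, k}" "T \<in> rot_orbit n {i, j, k}"
        and "(\<Prod>i\<in>S. var i) = (\<Prod>i\<in>T. var i)"
      then show "S = T"
        using poly_of_inj[of "{S}" "{T}"] fin by (auto simp: poly_of_def)
    qed
    then show ?thesis
      by (simp add: poly_of_def sum.reindex)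
  qed
  finally show ?thesis .
qed

text \<open>Removes the normalization that a triple contains 1: every triple has a translate
  containing 1, and translates have the same orbit.\<close>

lemma cubic_mrs_eq:
  assumes "0 < n"
  shows "cubic_mrs n = (\<lambda>S. poly_of (rot_orbit n S)) ` triples n"
proof (intro equalityI subsetI)
  fix f assume "f \<in> cubic_mrs n"
  then obtain j k where "f = mrs n (1, j, k)" "{1, j, k} \<in> triples n"
    using assms by (auto simp: cubic_mrs_def triples_def)
  then show "f \<in> (\<lambda>S. poly_of (rot_orbit n S)) ` triples n"
    using mrs_eq_poly_of[OF assms] by blast
next
  fix f assume "f \<in> (\<lambda>S. poly_of (rot_orbit n S)) ` triples n"
  then obtain S where S: "S \<in> triples n" "f = poly_of (rot_orbit n S)"
    by blast
  then have "S \<noteq> {}" "S \<subseteq> {1..n}"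
    by (auto simp: triples_def)
  then obtain a where a: "a \<in> S" "a \<in> {1..n}"
    by blast
  \<comment> \<open>This shift sends \<open>a\<close> to \<open>n + 1\<close>, which is 1 modulo
    \<open>n\<close>.\<close>
  define T where "T = shift n (n + 1 - a) ` S"
  have T: "T \<in> triples n"
    unfolding T_def by (intro permutes_triples shift_permutes assms S)
  have "shift n (n + 1 - a) a = 1"
    using a(2) by (simp add: shift_def of_nat_diff cmod_def)
  then have "1 \<in> T"
    unfolding T_def using a(1) by force
  moreover obtain x y z where xyz: "T = {x, y, z}" "x \<noteq> y" "x \<noteq> z" "y \<noteq> z"
    using T unfolding triples_def card_3_iff by blast
  ultimately have "x = 1 \<or> y = 1 \<or> z = 1"
    by blast
  moreover have "T = {y, x, z}" "T = {z, x, y}"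
    using xyz(1) by blast+
  ultimately obtain j k where jk: "T = {1, j, k}" "distinct [1, j, k]"
    using that[of y z] that[of x z] that[of x y] xyz by auto
  then have "j \<in> {1..n}" "k \<in> {1..n}"
    using T by (auto simp: triples_def)
  moreover have "f = mrs n (1, j, k)"
    using mrs_eq_poly_of[OF assms, of 1 j k] T jk(1) S(2) rot_orbit_shift[OF assms] T_def
    by metis
  ultimately show "f \<in> cubic_mrs n"
    using jk(2) unfolding cubic_mrs_def by blast
qed

section \<open>Rigidity of permutations compatible with translation\<close>

lemma cong_small_diff:
  fixes a b m :: int
  assumes "[a = b] (mod m)" "\<bar>a - b\<bar> < m"
  shows "a = b"
  using assms zdvd_not_zless[of "\<bar>a - b\<bar>" m] by (auto simp: cong_iff_dvd_diff)

text \<open>Converts an equality of point sets modulo \<open>n\<close> into an assignment of offsets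
  to \<open>x\<close>, \<open>y\<close>, \<open>z\<close>; distinct points must receive distinct
  offsets.\<close>

lemma cmod_triple_cong:
  assumes "0 < n"
    and "{cmod x n, cmod y n, cmod z n} = {cmod (b + b1) n, cmod (b + b2) n, cmod (b + b3) n}"
    and "cmod x n \<noteq> cmod y n" "cmod x n \<noteq> cmod z n" "cmod y n \<noteq> cmod z n"
  obtains i j k where "i \<in> {b1, b2, b3}" "j \<in> {b1, b2, b3}" "k \<in> {b1, b2, b3}"
    "i \<noteq> j" "i \<noteq> k" "j \<noteq> k"
    "[x = b + i] (mod int n)" "[y = b + j] (mod int n)" "[z = b + k] (mod int n)"
proof -
  have *: "\<exists>i\<in>{b1, b2, b3}. [w = b + i] (mod int n)" if "w \<in> {x, y, z}" for w
  proof -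
    have "cmod w n \<in> {cmod (b + b1) n, cmod (b + b2) n, cmod (b + b3) n}"
      using that assms(2) by blast
    then show ?thesis
      by (auto simp: cmod_eq_iff[OF assms(1)])
  qed
  obtain i j k where "i \<in> {b1, b2, b3}" "j \<in> {b1, b2, b3}" "k \<in> {b1, b2, b3}"
    and c: "[x = b + i] (mod int n)" "[y = b + j] (mod int n)" "[z = b + k] (mod int n)"
    using *[of x] *[of y] *[of z] by blast
  moreover have "i \<noteq> j" "i \<noteq> k" "j \<noteq> k"
    using c assms(3-5) unfolding cmod_eq_iff[OF assms(1)] by (metis cong_sym cong_trans)+
  ultimately show ?thesis
    using that by blast
qed

text \<open>The windows starting at \<open>a - 1\<close> and at \<open>a\<close> share the pair
  \<open>a\<close>, \<open>a + 1\<close>, and each goes to three consecutive residues. Offset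
  differences lie between -2 and 2, so congruent ones differ by at most 4 and are equal because
  \<open>n\<close> is at least 5.\<close>

lemma adjacent_windows:
  assumes n: "5 \<le> n"
    and p: "\<And>a b. [p a = p b] (mod int n) \<longleftrightarrow> [a = b] (mod int n)"
    and w: "\<And>a. \<exists>b. {cmod (p a) n, cmod (p (a + 1)) n, cmod (p (a + 2)) n}
        = {cmod (b + 0) n, cmod (b + 1) n, cmod (b + 2) n}"
  shows "[p (a + 1) = p a + 1] (mod int n) \<or> [p (a + 1) = p a - 1] (mod int n)"
proof -
  have n0: "0 < n"
    using n by simp
  have neq: "cmod (p c) n \<noteq> cmod (p d) n" if "0 < \<bar>c - d\<bar>" "\<bar>c - d\<bar> < int n" for c d
    using that cong_small_diff[of c d "int n"] unfolding cmod_eq_iff[OF n0] p by auto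
  obtain b i j k where ijk: "i \<in> {0, 1, 2}" "j \<in> {0, 1, 2}" "k \<in> {0, 1, 2}"
    "i \<noteq> j" "i \<noteq> k" "j \<noteq> k" "[p a = b + i] (mod int n)"
    "[p (a + 1) = b + j] (mod int n)" "[p (a + 2) = b + k] (mod int n)"
  proof -
    obtain b where "{cmod (p a) n, cmod (p (a + 1)) n, cmod (p (a + 2)) n}
        = {cmod (b + 0) n, cmod (b + 1) n, cmod (b + 2) n}"
      using w by blast
    then show ?thesis
      by (rule cmod_triple_cong[OF n0]) (use n neq that in auto)
  qed
  obtain b' i' j' k' where ijk': "i' \<in> {0, 1, 2}" "j' \<in> {0, 1, 2}" "k' \<in> {0, 1, 2}"
    "i' \<noteq> j'" "i' \<noteq> k'" "j' \<noteq> k'" "[p (a - 1) = b' + i'] (mod int n)"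
    "[p a = b' + j'] (mod int n)" "[p (a + 1) = b' + k'] (mod int n)"
  proof -
    have "a - 1 + 1 = a" "a - 1 + 2 = a + 1"
      by simp_all
    from w[of "a - 1", unfolded this] obtain b
      where "{cmod (p (a - 1)) n, cmod (p a) n, cmod (p (a + 1)) n}
        = {cmod (b + 0) n, cmod (b + 1) n, cmod (b + 2) n}"
      by (elim exE)
    then show ?thesis
      by (rule cmod_triple_cong[OF n0]) (use n neq that in auto)
  qed
  have d: "[p (a + 1) = p a + (j - i)] (mod int n)"
    using cong_add[OF cong_diff[OF ijk(8,7)] cong_refl[of "p a"]] by (simp add: algebra_simps)
  have "[j - i = k' - j'] (mod int n)"
  proof -
    have "[p (a + 1) - p a = j - i] (mod int n)"
      using cong_diff[OF ijk(8,7)] by simp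
    moreover have "[p (a + 1) - p a = k' - j'] (mod int n)"
      using cong_diff[OF ijk'(9,8)] by simp
    ultimately show ?thesis
      by (metis cong_sym cong_trans)
  qed
  \<comment> \<open>Both windows put \<open>p a\<close> and \<open>p (a + 1)\<close> at the same offset; if that offset is 2, both
    remaining points \<open>p (a + 2)\<close> and \<open>p (a - 1)\<close> are the midpoint.\<close>
  then have eq: "j - i = k' - j'"
    by (rule cong_small_diff) (use ijk(1,2) ijk'(2,3) n in auto)
  show ?thesis
  proof (cases "\<bar>j - i\<bar> = 1")
    case True
    then have "j - i = 1 \<or> j - i = -1"
      by linarith
    then show ?thesis
      using d by auto
  next
    case False
    then have "k - i = i' - j'"
      using eq ijk(1-6) ijk'(1-6) by auto
    moreover have "[p (a + 2) - p a = k - i] (mod int n)"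
      using cong_diff[OF ijk(9,7)] by simp
    moreover have "[p (a - 1) - p a = i' - j'] (mod int n)"
      using cong_diff[OF ijk'(7,8)] by simp
    ultimately have "[p (a + 2) - p a = p (a - 1) - p a] (mod int n)"
      by (metis cong_sym cong_trans)
    then have "[p (a + 2) = p (a - 1)] (mod int n)"
      by (simp add: cong_iff_dvd_diff)
    then have "cmod (p (a + 2)) n = cmod (p (a - 1)) n"
      by (simp add: cmod_eq_iff[OF n0])
    then show ?thesis
      using neq[of "a + 2" "a - 1"] n by simp
  qed
qed

lemma cmod_triple_triples:
  assumes "0 < n" "cmod x n \<noteq> cmod y n" "cmod x n \<noteq> cmod z n" "cmod y n \<noteq> cmod z n"
  shows "{cmod x n, cmod y n, cmod z n} \<in> triples n"
  using assms cmod_mem[OF assms(1)] by (auto simp: triples_def simp del: One_nat_def)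

lemma triple_preserving_is_shift:
  assumes n: "6 \<le> n" and \<pi>: "\<pi> permutes {1..n}"
    and orb: "\<And>S. S \<in> triples n \<Longrightarrow> \<pi> ` S \<in> rot_orbit n S"
  obtains s where "\<pi> = shift n s"
proof -
  have n0: "0 < n"
    using n by simp
  \<comment> \<open>The permutation becomes a function on the integers depending only on the
    argument modulo \<open>n\<close>, so that neighbours such as \<open>a - 1\<close> and
    \<open>a + 1\<close> need no wrap-around.\<close>
  define p where "p a = int (\<pi> (cmod a n))" for a
  have cp: "cmod (p a) n = \<pi> (cmod a n)" for a
    unfolding p_def by (intro cmod_of_nat) (use permutes_in_image[OF \<pi>] cmod_mem[OF n0] in blast)
  have p: "[p a = p b] (mod int n) \<longleftrightarrow> [a = b] (mod int n)" for a b
    unfolding cmod_eq_iff[OF n0, symmetric] cp using permutes_inj[OF \<pi>] by (simp add: inj_eq)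
  have dist: "cmod c n \<noteq> cmod d n" if "0 < \<bar>c - d\<bar>" "\<bar>c - d\<bar> < int n" for c d
    using that cong_small_diff[of c d "int n"] unfolding cmod_eq_iff[OF n0] by auto
  have triple: "\<exists>b. {cmod (p a) n, cmod (p (a + 1)) n, cmod (p (a + c)) n}
      = {cmod (b + 0) n, cmod (b + 1) n, cmod (b + c) n}" if "c \<in> {2, 3}" for a c
  proof -
    have "{cmod a n, cmod (a + 1) n, cmod (a + c) n} \<in> triples n"
      by (rule cmod_triple_triples[OF n0]; rule dist) (use that n in auto)
    then obtain t where "\<pi> ` {cmod a n, cmod (a + 1) n, cmod (a + c) n}
        = shift n t ` {cmod a n, cmod (a + 1) n, cmod (a + c) n}"
      using orb unfolding rot_orbit_def by blast
    then have "{cmod (p a) n, cmod (p (a + 1)) n, cmod (p (a + c)) n}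
      = {cmod (a + int t + 0) n, cmod (a + int t + 1) n, cmod (a + int t + c) n}"
      by (simp add: cp shift_cmod[OF n0] algebra_simps)
    then show ?thesis
      by blast
  qed
  have adj: "[p (a + 1) = p a + 1] (mod int n) \<or> [p (a + 1) = p a - 1] (mod int n)" for a
    by (rule adjacent_windows) (use n p triple in auto)
  then obtain e where e: "e \<in> {1, -1}" "[p 1 = p 0 + e] (mod int n)"
    by (metis add.commute add_0 diff_conv_add_uminus insertCI)
  have step: "[p (int k + 1) = p (int k) + e] (mod int n)" for k
  proof (induction k)
    case 0
    then show ?case
      using e(2) by simp
  next
    case (Suc k)
    \<comment> \<open>A change of direction would give \<open>k\<close> and \<open>k + 2\<close> the
      same image, against injectivity.\<close>
    have "\<not> [p (int k + 1 + 1) = p (int k + 1) - e] (mod int n)"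
    proof
      assume "[p (int k + 1 + 1) = p (int k + 1) - e] (mod int n)"
      from cong_add[OF this Suc.IH] have "[p (int k + 2) = p (int k)] (mod int n)"
        by (simp add: cong_iff_dvd_diff algebra_simps)
      then have "[int k + 2 = int k] (mod int n)"
        by (simp add: p)
      from cong_small_diff[OF this] show False
        using n by simp
    qed
    then show ?case
      using adj[of "int k + 1"] e(1) by (auto simp: add.commute)
  qed
  have lin: "[p (int k) = p 0 + e * int k] (mod int n)" for k
  proof (induction k)
    case (Suc k)
    from cong_add[OF step[of k] Suc.IH] show ?case
      by (simp add: cong_iff_dvd_diff algebra_simps)
  qed simp
  have "e = 1"
  proof (rule ccontr)
    assume "e \<noteq> 1"
    then have e: "e = -1"
      using e(1) by simp
    \<comment> \<open>The triple 0, 1, 3 distinguishes the two directions: slope -1 would send it to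
      \<open>p 0\<close>, \<open>p 0 - 1\<close>, \<open>p 0 - 3\<close>.\<close>
    obtain b where b: "{cmod (p 0) n, cmod (p (0 + 1)) n, cmod (p (0 + 3)) n}
        = {cmod (b + 0) n, cmod (b + 1) n, cmod (b + 3) n}"
      using triple[of 3 0] by blast
    obtain i j k where ijk: "i \<in> {0, 1, 3}" "j \<in> {0, 1, 3}" "k \<in> {0, 1, 3}"
      "[p 0 = b + i] (mod int n)" "[p (0 + 1) = b + j] (mod int n)" "[p (0 + 3) = b + k] (mod int n)"
      by (rule cmod_triple_cong[OF n0 b]) (use n dist p that in \<open>auto simp: cmod_eq_iff[OF n0]\<close>)
    have l: "[p 1 = p 0 - 1] (mod int n)" "[p 3 = p 0 - 3] (mod int n)"
      using lin[of 1] lin[of 3] e by simp_all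
    have "[i - j = 1] (mod int n)"
      using cong_add[OF cong_diff[OF ijk(5,4)] l(1)[THEN cong_sym]]
      by (simp add: cong_iff_dvd_diff algebra_simps)
    then have "i - j = 1"
      by (rule cong_small_diff) (use ijk n in auto)
    have "[i - k = 3] (mod int n)"
      using cong_add[OF cong_diff[OF ijk(6,4)] l(2)[THEN cong_sym]]
      by (simp add: cong_iff_dvd_diff algebra_simps)
    \<comment> \<open>Here \<open>i\<close> is 1, so \<open>i - k - 3\<close> can be as low as -5,
      and \<open>n\<close> at least 6 is needed. Modulo 5 the reflected set 0, -1, -3 is indeed a
      translate of 0, 1, 3.\<close>
    then have "i - k = 3"
      by (rule cong_small_diff) (use ijk(1-3) \<open>i - j = 1\<close> n in auto)
    then show False
      using \<open>i - j = 1\<close> ijk(1-3) by auto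
  qed
  \<comment> \<open>Since \<open>cmod 0 n\<close> is \<open>n\<close>, the value \<open>p 0\<close>
    is the image of the index \<open>n\<close>, hence the translation amount modulo
    \<open>n\<close>.\<close>
  have "\<pi> = shift n (nat (p 0 mod int n))"
  proof
    fix i
    show "\<pi> i = shift n (nat (p 0 mod int n)) i"
    proof (cases "i \<in> {1..n}")
      case True
      then have "\<pi> i = cmod (p (int i)) n"
        by (simp only: cp cmod_of_nat)
      also have "\<dots> = cmod (int i + p 0 mod int n) n"
        using lin[of i] \<open>e = 1\<close> unfolding cmod_eq_iff[OF n0]
        by (simp add: cong_def mod_simps add.commute)
      also have "\<dots> = shift n (nat (p 0 mod int n)) i"
        using True n0 by (simp add: shift_def)
      finally show ?thesis .
    next
      case False
      then show ?thesis
        using permutes_not_in[OF \<pi>] by (auto simp: shift_def)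
    qed
  qed
  then show ?thesis
    using that by blast
qed

text \<open>Iterating the commutation relation shows that \<sigma> advances by \<open>k\<close> when
  its argument advances by \<open>k * s\<close>. Choosing \<open>k\<close> with \<open>k * s\<close>
  congruent to 1 makes \<sigma> affine of slope \<open>k\<close>.\<close>

lemma normalizing_permutation_affine:
  assumes n: "2 \<le> n" and \<sigma>: "\<sigma> permutes {1..n}"
    and comm: "shift n 1 \<circ> \<sigma> = \<sigma> \<circ> shift n s"
  obtains \<tau> t where "gcd \<tau> (int n) = 1" "\<sigma> = shift n t \<circ> sigma \<tau> n"
proof -
  have n0: "0 < n"
    using n by simp
  have iter: "shift n k (\<sigma> x) = \<sigma> (shift n (k * s) x)" for k x
  proof (induction k arbitrary: x)
    case 0
    then show ?case
      by (simp add: shift_0[OF n0])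
  next
    case (Suc k)
    have "shift n (Suc k) (\<sigma> x) = shift n k (shift n 1 (\<sigma> x))"
      using shift_shift[OF n0, of k 1] by (simp add: fun_eq_iff)
    also have "\<dots> = shift n k (\<sigma> (shift n s x))"
      using comm by (simp add: fun_eq_iff)
    also have "\<dots> = \<sigma> (shift n (Suc k * s) x)"
      using Suc.IH[of "shift n s x"] shift_shift[OF n0, of "k * s" s]
      by (simp add: fun_eq_iff add.commute)
    finally show ?case .
  qed
  have in_range: "\<sigma> i \<in> {1..n}" if "i \<in> {1..n}" for i
    using permutes_in_image[OF \<sigma>] that by blast
  have \<sigma>1: "\<sigma> (cmod (int (k * s) + 1) n) = cmod (int (\<sigma> 1) + int k) n" for k
  proof -
    have "\<sigma> (cmod (int (k * s) + 1) n) = \<sigma> (shift n (k * s) 1)"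
      using n by (simp add: shift_def add.commute)
    also have "\<dots> = shift n k (\<sigma> 1)"
      by (simp only: iter)
    also have "\<dots> = cmod (int (\<sigma> 1) + int k) n"
      using in_range[of 1] n by (simp add: shift_def)
    finally show ?thesis .
  qed
  \<comment> \<open>The candidate slope is the increment of \<sigma> from 1 to 2; injectivity of
    \<sigma> then shows that it is inverse to \<open>s\<close> modulo \<open>n\<close>.\<close>
  define k where "k = nat ((int (\<sigma> 2) - int (\<sigma> 1)) mod int n)"
  have "\<sigma> (cmod (int (k * s) + 1) n) = cmod (int (\<sigma> 2)) n"
    unfolding \<sigma>1 cmod_eq_iff[OF n0] using n0 by (simp add: k_def cong_def mod_simps)
  also have "\<dots> = \<sigma> (cmod 2 n)"
    using cmod_of_nat[OF in_range[of 2]] cmod_of_nat[of 2 n] n by simp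
  finally have "cmod (int (k * s) + 1) n = cmod 2 n"
    using permutes_inj[OF \<sigma>] by (simp only: inj_eq)
  then have ks: "[int k * int s = 1] (mod int n)"
    by (simp add: cmod_eq_iff[OF n0] cong_iff_dvd_diff)
  then have "gcd (int k) (int n) = 1"
    by (metis coprime_iff_invertible_int coprime_iff_gcd_eq_1)
  \<comment> \<open>As \<open>sigma\<close> fixes 1, the translation part must carry 1 to
    \<open>\<sigma> 1\<close>.\<close>
  moreover have "\<sigma> = shift n (\<sigma> 1 - 1) \<circ> sigma (int k) n"
  proof
    fix i
    show "\<sigma> i = (shift n (\<sigma> 1 - 1) \<circ> sigma (int k) n) i"
    proof (cases "i \<in> {1..n}")
      case True
      have "i = cmod (int ((i - 1) * k * s) + 1) n"
      proof -
        have "[int (i - 1) * (int k * int s) + 1 = int (i - 1) * 1 + 1] (mod int n)"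
          by (intro cong_add cong_mult cong_refl ks)
        then have "cmod (int ((i - 1) * k * s) + 1) n = cmod (int i) n"
          using True by (simp add: cmod_eq_iff[OF n0] of_nat_diff mult.assoc)
        then show ?thesis
          using cmod_of_nat[OF True] by simp
      qed
      then have "\<sigma> i = cmod (int (\<sigma> 1) + int ((i - 1) * k)) n"
        using \<sigma>1[of "(i - 1) * k"] by simp
      also have "\<dots> = shift n (\<sigma> 1 - 1) (sigma (int k) n i)"
        using True in_range[of 1] n
        by (simp add: sigma_def shift_cmod[OF n0] of_nat_diff algebra_simps)
      finally show ?thesis
        by simp
    next
      case False
      then show ?thesis
        using permutes_not_in[OF \<sigma>] by (auto simp: shift_def sigma_def)
    qed
  qed
  ultimately show ?thesis
    by (rule that)
qed

section \<open>The action of the group on cubic MRS functions\<close>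

text \<open>The representation chosen in \<open>D n\<close> is one of \<open>f\<close> itself, so
  passing through it changes nothing.\<close>

lemma mrs_action_eq:
  assumes "f \<in> cubic_mrs n"
  shows "mrs_action n \<sigma> f = rename_vars \<sigma> f"
  using theI'[OF D_unique_representation[OF assms]] assms by (auto simp: mrs_action_def)

lemma rename_vars_id:
  assumes "0 < n" "f \<in> cubic_mrs n"
  shows "rename_vars id f = f"
  using assms by (auto simp: cubic_mrs_eq rename_vars_rot_orbit)

text \<open>On families of index sets renaming is formation of images, which respects
  composition.\<close>

lemma rename_vars_comp:
  assumes "0 < n" "f \<in> cubic_mrs n" "\<sigma> permutes {1..n}" "\<rho> permutes {1..n}"
  shows "rename_vars (\<rho> \<circ> \<sigma>) f = rename_vars \<rho> (rename_vars \<sigma> f)"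
proof -
  obtain S where S: "S \<in> triples n" "f = poly_of (rot_orbit n S)"
    using assms(1,2) by (auto simp: cubic_mrs_eq)
  have inj: "inj \<sigma>" "inj \<rho>"
    using assms(3,4) by (auto intro: permutes_inj)
  have "finite ((`) \<sigma> ` rot_orbit n S)"
    by (intro finite_imageI finite_rot_orbit assms)
  moreover have "finite T" if "T \<in> (`) \<sigma> ` rot_orbit n S" for T
    using that rot_orbit_triples[OF assms(1) S(1)] finite_triples by blast
  ultimately have "rename_vars \<rho> (poly_of ((`) \<sigma> ` rot_orbit n S))
      = poly_of ((`) \<rho> ` (`) \<sigma> ` rot_orbit n S)"
    using inj(2) by (rule rename_vars_poly_of)
  then show ?thesis
    using inj_compose[OF inj(2,1)] inj(1)
    by (simp only: S(2) rename_vars_rot_orbit[OF assms(1) S(1)] image_image_sets)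
qed

lemma rename_vars_sigma:
  assumes "0 < n" "S \<in> triples n" "gcd \<tau> (int n) = 1"
  shows "rename_vars (sigma \<tau> n) (poly_of (rot_orbit n S)) = poly_of (rot_orbit n (sigma \<tau> n ` S))"
  using assms permutes_inj[OF sigma_permutes]
  by (simp add: rename_vars_rot_orbit sigma_image_rot_orbit)

lemma sigma_cubic_mrs:
  assumes "0 < n" "f \<in> cubic_mrs n" "gcd \<tau> (int n) = 1"
  shows "rename_vars (sigma \<tau> n) f \<in> cubic_mrs n"
  using assms permutes_triples[OF sigma_permutes] by (auto simp: cubic_mrs_eq rename_vars_sigma)

text \<open>Allows the translation part of an affine permutation to be discarded.\<close>

lemma rename_vars_shift:
  assumes "0 < n" "f \<in> cubic_mrs n"
  shows "rename_vars (shift n t) f = f"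
  using assms permutes_inj[OF shift_permutes]
  by (auto simp: cubic_mrs_eq rename_vars_rot_orbit shift_image_rot_orbit)

lemma sigma_preserves_rotation_symmetry:
  assumes "0 < n" "gcd \<tau> (int n) = 1"
  shows "preserves_rotation_symmetry n (sigma \<tau> n)"
  using assms sigma_permutes sigma_cubic_mrs rename_vars_shift
  by (auto simp: preserves_rotation_symmetry_def rotation_symmetric_def)

lemma carrier_G: "carrier (G n) = (\<lambda>\<tau>. sigma \<tau> n) ` {\<tau>. gcd \<tau> (int n) = 1}"
  by (auto simp: G_def)

lemma mult_G: "mult (G n) = (\<circ>)"
  by (simp add: G_def sym_group_def)

lemma one_G: "one (G n) = id"
  by (simp add: G_def sym_group_def)

lemma carrier_G_permutes: "0 < n \<Longrightarrow> \<sigma> \<in> carrier (G n) \<Longrightarrow> \<sigma> permutes {1..n}"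
  using sigma_permutes by (auto simp: carrier_G)

lemma group_G:
  assumes "0 < n"
  shows "group (G n)"
proof (rule groupI)
  fix x y assume "x \<in> carrier (G n)" "y \<in> carrier (G n)"
  then obtain \<tau> \<upsilon> where "x = sigma \<tau> n" "y = sigma \<upsilon> n" "gcd \<tau> (int n) = 1" "gcd \<upsilon> (int n) = 1"
    by (auto simp: carrier_G)
  moreover from this have "gcd (\<tau> * \<upsilon>) (int n) = 1"
    by (simp add: coprime_iff_gcd_eq_1[symmetric])
  ultimately show "x \<otimes>\<^bsub>G n\<^esub> y \<in> carrier (G n)"
    using sigma_sigma[OF assms] by (auto simp: carrier_G mult_G)
next
  show "\<one>\<^bsub>G n\<^esub> \<in> carrier (G n)"
    unfolding carrier_G one_G using sigma_1[OF assms] by (intro image_eqI[of _ _ 1]) simp_all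
next
  fix x assume "x \<in> carrier (G n)"
  then obtain \<tau> where \<tau>: "x = sigma \<tau> n" "gcd \<tau> (int n) = 1"
    by (auto simp: carrier_G)
  obtain \<upsilon> where \<upsilon>: "gcd \<upsilon> (int n) = 1" "sigma \<upsilon> n \<circ> sigma \<tau> n = id"
    by (rule sigma_inverse[OF assms \<tau>(2)])
  have "sigma \<upsilon> n \<in> carrier (G n)"
    using \<upsilon>(1) by (auto simp: carrier_G)
  then show "\<exists>y\<in>carrier (G n). y \<otimes>\<^bsub>G n\<^esub> x = \<one>\<^bsub>G n\<^esub>"
    using \<tau>(1) \<upsilon>(2) by (intro bexI[of _ "sigma \<upsilon> n"]) (simp_all add: mult_G one_G)
qed (auto simp: mult_G one_G comp_assoc)

lemma group_action_G:
  assumes "0 < n"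
  shows "group_action (G n) (cubic_mrs n) (mrs_action n)"
proof -
  have closed: "mrs_action n \<sigma> f \<in> cubic_mrs n" if "\<sigma> \<in> carrier (G n)" "f \<in> cubic_mrs n" for \<sigma> f
    using that sigma_cubic_mrs[OF assms] by (auto simp: carrier_G mrs_action_eq)
  have comp: "mrs_action n (\<sigma> \<circ> \<rho>) f = mrs_action n \<sigma> (mrs_action n \<rho> f)"
    if "\<sigma> \<in> carrier (G n)" "\<rho> \<in> carrier (G n)" "f \<in> cubic_mrs n" for \<sigma> \<rho> f
    unfolding mrs_action_eq[OF that(3)]
      mrs_action_eq[OF closed[OF that(2,3), unfolded mrs_action_eq[OF that(3)]]]
    by (rule rename_vars_comp[OF assms that(3) carrier_G_permutes[OF assms that(2)]
          carrier_G_permutes[OF assms that(1)]])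
  \<comment> \<open>Bijectivity is witnessed by the inverse slope, extensionality by the restriction
    in \<open>mrs_action\<close>.\<close>
  have Bij: "mrs_action n \<sigma> \<in> Bij (cubic_mrs n)" if \<sigma>: "\<sigma> \<in> carrier (G n)" for \<sigma>
  proof -
    obtain \<tau> where \<tau>: "\<sigma> = sigma \<tau> n" "gcd \<tau> (int n) = 1"
      using \<sigma> by (auto simp: carrier_G)
    obtain \<upsilon> where \<upsilon>: "gcd \<upsilon> (int n) = 1" "sigma \<upsilon> n \<circ> \<sigma> = id" "\<sigma> \<circ> sigma \<upsilon> n = id"
      unfolding \<tau>(1) by (rule sigma_inverse[OF assms \<tau>(2)])
    have \<rho>: "sigma \<upsilon> n \<in> carrier (G n)"
      using \<upsilon>(1) by (auto simp: carrier_G)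
    have "mrs_action n (sigma \<upsilon> n) (mrs_action n \<sigma> f) = f"
      "mrs_action n \<sigma> (mrs_action n (sigma \<upsilon> n) f) = f" if "f \<in> cubic_mrs n" for f
      using comp[OF \<sigma> \<rho> that] comp[OF \<rho> \<sigma> that] \<upsilon>(2,3) rename_vars_id[OF assms that]
      by (simp_all add: mrs_action_eq[OF that])
    then have "bij_betw (mrs_action n \<sigma>) (cubic_mrs n) (cubic_mrs n)"
      using closed \<sigma> \<rho> by (intro bij_betw_byWitness[of _ "mrs_action n (sigma \<upsilon> n)"]) auto
    then show ?thesis
      by (simp add: Bij_def mrs_action_def)
  qed
  have "mrs_action n (\<sigma> \<circ> \<rho>) = compose (cubic_mrs n) (mrs_action n \<sigma>) (mrs_action n \<rho>)"
    if "\<sigma> \<in> carrier (G n)" "\<rho> \<in> carrier (G n)" for \<sigma> \<rho>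
  proof (rule extensionalityI)
    show "mrs_action n (\<sigma> \<circ> \<rho>) \<in> extensional (cubic_mrs n)"
      by (simp add: mrs_action_def)
  qed (use that comp in \<open>auto simp: compose_def\<close>)
  then have "mrs_action n \<in> hom (G n) (BijGroup (cubic_mrs n))"
    using Bij by (auto simp: hom_def BijGroup_def mult_G)
  then show ?thesis
    by (intro group_action.intro group_hom.intro group_hom_axioms.intro group_G group_BijGroup assms)
qed

section \<open>Orbits and affine equivalence classes\<close>

text \<open>Reduces the theorem to identifying \<open>affine_equiv n\<close> with the orbit
  relation.\<close>

lemma (in group_action)
  defines "R \<equiv> {(x, y). x \<in> E \<and> y \<in> orbit G \<phi> x}"
  shows equiv_orbit: "equiv E R" and orbits_quotient: "orbits G E \<phi> = E // R"
proof -
  have E: "y \<in> E" if "x \<in> E" "y \<in> orbit G \<phi> x" for x y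
    using that element_image by (auto simp: orbit_def)
  show "equiv E R"
  proof (rule equivI)
    show "R \<subseteq> E \<times> E"
      using E by (auto simp: R_def)
    show "refl_on E R"
      using orbit_refl by (auto simp: refl_on_def R_def)
    show "sym R"
      using orbit_sym E by (auto simp: sym_def R_def)
    show "trans R"
      using orbit_trans E unfolding trans_def R_def by blast
  qed
  have "R `` {x} = orbit G \<phi> x" if "x \<in> E" for x
    using that by (auto simp: R_def)
  then show "orbits G E \<phi> = E // R"
    by (auto simp: orbits_def quotient_def)
qed

text \<open>For \<open>n\<close> equal to 3 or 4 all triples are translates of
  \<open>{1, 2, 3}\<close>. For \<open>n = 5\<close> the ten triples form two translation orbits,
  interchanged by slope 2.\<close>

lemma small_single_orbit:
  assumes "n \<in> {3, 4, 5}" "S \<in> triples n"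
  obtains \<tau> where "gcd \<tau> (int n) = 1" "rot_orbit n S = rot_orbit n (sigma \<tau> n ` {1, 2, 3})"
proof -
  have S: "S \<in> Pow {1..n}" "card S = 3" and n: "0 < n"
    using assms by (auto simp: triples_def)
  \<comment> \<open>As \<open>n\<close> is at most 5, the shifts 0 to 4 cover all residues, and the
    explicit sets can be evaluated by simplification.\<close>
  let ?orb = "\<lambda>n \<tau>. (\<lambda>t. shift n t ` sigma \<tau> n ` {1, 2, 3}) ` {0, 1, 2, 3, 4}"
  have "\<exists>\<tau>\<in>{1, 2}. gcd \<tau> (int n) = 1 \<and> S \<in> ?orb n \<tau>"
  proof -
    consider "n = 3" | "n = 4" | "n = 5"
      using assms(1) by blast
    then show ?thesis
    proof cases
      case 1
      have "{1..n} = {1, 2, 3}"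
        using 1 by auto
      then have "S \<in> {{1, 2, 3}}"
        using S by (simp add: Pow_insert) (elim disjE; simp)
      also have "\<dots> \<subseteq> ?orb 3 1"
        by (simp add: shift_def sigma_def cmod_def insert_commute eval_nat_numeral)
      finally show ?thesis
        using 1 by simp
    next
      case 2
      have "{1..n} = {1, 2, 3, 4}"
        using 2 by auto
      then have "S \<in> {{1, 2, 3}, {2, 3, 4}, {1, 3, 4}, {1, 2, 4}}"
        using S by (simp add: Pow_insert) (elim disjE; simp)
      also have "\<dots> \<subseteq> ?orb 4 1"
        by (simp add: shift_def sigma_def cmod_def insert_commute eval_nat_numeral)
      finally show ?thesis
        using 2 by simp
    next
      case 3
      have "{1..n} = {1, 2, 3, 4, 5}"
        using 3 by auto
      \<comment> \<open>The first five sets are the translates of \<open>{1, 2, 3}\<close>, the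
        other five those of \<open>{1, 3, 5}\<close>, its image under slope 2.\<close>
      then have "S \<in> {{1, 2, 3}, {2, 3, 4}, {3, 4, 5}, {1, 4, 5}, {1, 2, 5}} \<union>
          {{1, 3, 5}, {1, 2, 4}, {2, 3, 5}, {1, 3, 4}, {2, 4, 5}}"
        using S by (simp add: Pow_insert) (elim disjE; simp)
      also have "\<dots> \<subseteq> ?orb 5 1 \<union> ?orb 5 2"
        by (simp add: shift_def sigma_def cmod_def insert_commute eval_nat_numeral)
      finally have "S \<in> ?orb 5 1 \<or> S \<in> ?orb 5 2"
        by (simp only: Un_iff)
      moreover have "gcd 1 (int n) = 1" "gcd 2 (int n) = 1"
        using 3 by (simp_all add: gcd_red_int[of 2 5] gcd_red_int[of 5 2])
      ultimately show ?thesis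
        using 3 bexI[of "\<lambda>\<tau>. gcd \<tau> (int n) = 1 \<and> S \<in> ?orb n \<tau>" 1 "{1, 2}"]
          bexI[of "\<lambda>\<tau>. gcd \<tau> (int n) = 1 \<and> S \<in> ?orb n \<tau>" 2 "{1, 2}"]
        by (simp only: insert_iff simp_thms) blast
    qed
  qed
  then obtain \<tau> t where "gcd \<tau> (int n) = 1" "S = shift n t ` sigma \<tau> n ` {1, 2, 3}"
    by (elim bexE conjE imageE) (rule that)
  then show ?thesis
    by (intro that[of \<tau>]) (simp_all only: rot_orbit_shift[OF n])
qed

text \<open>Rotation symmetry of the image of each MRS function makes the conjugate \<pi> of the
  unit shift send every triple into its own orbit. Thus \<pi> is a shift, and \<sigma> conjugates it
  to the unit shift.\<close>

lemma large_preserving_affine: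
  assumes n: "6 \<le> n" and \<sigma>: "preserves_rotation_symmetry n \<sigma>"
  obtains \<tau> t where "gcd \<tau> (int n) = 1" "\<sigma> = shift n t \<circ> sigma \<tau> n"
proof -
  have n0: "0 < n"
    using n by simp
  have perm: "\<sigma> permutes {1..n}"
    using \<sigma> by (simp add: preserves_rotation_symmetry_def)
  define \<pi> where "\<pi> = inv' \<sigma> \<circ> (shift n 1 \<circ> \<sigma>)"
  have \<pi>: "\<pi> permutes {1..n}"
    unfolding \<pi>_def by (intro permutes_compose perm shift_permutes n0 permutes_inv)
  have "\<pi> ` S \<in> rot_orbit n S" if S: "S \<in> triples n" for S
  proof -
    let ?f = "poly_of (rot_orbit n S)"
    have f: "?f \<in> cubic_mrs n"
      using S n0 by (auto simp: cubic_mrs_eq)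
    \<comment> \<open>This is rotation symmetry of the renamed function for the single shift
      \<open>t = 1\<close>.\<close>
    have "rename_vars (shift n 1 \<circ> \<sigma>) ?f = rename_vars \<sigma> ?f"
      using \<sigma> f n rename_vars_comp[OF n0 f perm shift_permutes[OF n0]]
      by (simp add: preserves_rotation_symmetry_def rotation_symmetric_def)
    then have "poly_of ((`) (shift n 1 \<circ> \<sigma>) ` rot_orbit n S) = poly_of ((`) \<sigma> ` rot_orbit n S)"
      using permutes_inj[OF perm] permutes_inj[OF permutes_compose[OF perm shift_permutes[OF n0]]]
      by (simp only: rename_vars_rot_orbit[OF n0 S])
    then have "(`) (shift n 1 \<circ> \<sigma>) ` rot_orbit n S = (`) \<sigma> ` rot_orbit n S"
      by (rule poly_of_inj[rotated -1])
        (use rot_orbit_triples[OF n0 S] finite_triples finite_rot_orbit[OF n0] in blast)+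
    then have "(shift n 1 \<circ> \<sigma>) ` S \<in> (`) \<sigma> ` rot_orbit n S"
      using mem_rot_orbit[OF n0, of S] by blast
    then obtain T where T: "T \<in> rot_orbit n S" "(shift n 1 \<circ> \<sigma>) ` S = \<sigma> ` T"
      by blast
    have "\<pi> ` S = inv' \<sigma> ` (shift n 1 \<circ> \<sigma>) ` S"
      by (simp only: \<pi>_def image_comp)
    also have "\<dots> = T"
      using T(2) permutes_inj[OF perm] by simp
    finally show ?thesis
      using T(1) by simp
  qed
  then obtain s where s: "\<pi> = shift n s"
    using triple_preserving_is_shift[OF n \<pi>] by blast
  have "\<sigma> \<circ> \<pi> = shift n 1 \<circ> \<sigma>"
    using permutes_inverses[OF perm] by (auto simp: \<pi>_def fun_eq_iff)
  then have "shift n 1 \<circ> \<sigma> = \<sigma> \<circ> shift n s"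
    using s by simp
  then show ?thesis
    using normalizing_permutation_affine[OF _ perm] n that by auto
qed

lemma affine_equiv_orbit:
  assumes n: "3 \<le> n"
  shows "affine_equiv n = {(f, g). f \<in> cubic_mrs n \<and> g \<in> orbit (G n) (mrs_action n) f}"
proof -
  have n0: "0 < n"
    using n by simp
  interpret group_action "G n" "cubic_mrs n" "mrs_action n"
    using n0 by (rule group_action_G)
  have orbit_eq: "orbit (G n) (mrs_action n) f
      = (\<lambda>\<tau>. rename_vars (sigma \<tau> n) f) ` {\<tau>. gcd \<tau> (int n) = 1}"
    if "f \<in> cubic_mrs n" for f
    by (simp only: orbit_def Setcompr_eq_image carrier_G image_image mrs_action_eq[OF that])
  have "g \<in> orbit (G n) (mrs_action n) f"
    if f: "f \<in> cubic_mrs n" and g: "g \<in> cubic_mrs n"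
      and \<sigma>: "preserves_rotation_symmetry n \<sigma>" "rename_vars \<sigma> f = g" for f g \<sigma>
  proof (cases "6 \<le> n")
    case True
    obtain \<tau> t where \<tau>: "gcd \<tau> (int n) = 1" "\<sigma> = shift n t \<circ> sigma \<tau> n"
      using large_preserving_affine[OF True \<sigma>(1)] by blast
    have "g = rename_vars (sigma \<tau> n) f"
      using \<sigma>(2) \<tau> rename_vars_comp[OF n0 f sigma_permutes[OF n0 \<tau>(1)] shift_permutes[OF n0]]
        rename_vars_shift[OF n0 sigma_cubic_mrs[OF n0 f \<tau>(1)]] by simp
    then show ?thesis
      using \<tau>(1) unfolding orbit_eq[OF f] by simp
  next
    case False
    then have n': "n \<in> {3, 4, 5}"
      using n by auto
    let ?f0 = "poly_of (rot_orbit n {1, 2, 3})"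
    have S0: "{1, 2, 3} \<in> triples n"
      using n by (auto simp: triples_def)
    then have f0: "?f0 \<in> cubic_mrs n"
      using n0 by (auto simp: cubic_mrs_eq)
    \<comment> \<open>All cubic MRS functions lie in the orbit of \<open>?f0\<close>; symmetry and
      transitivity then place \<open>g\<close> in the orbit of \<open>f\<close>.\<close>
    have "h \<in> orbit (G n) (mrs_action n) ?f0" if h: "h \<in> cubic_mrs n" for h
    proof -
      obtain S where S: "S \<in> triples n" "h = poly_of (rot_orbit n S)"
        using h n0 by (auto simp: cubic_mrs_eq)
      obtain \<tau> where "gcd \<tau> (int n) = 1" "rot_orbit n S = rot_orbit n (sigma \<tau> n ` {1, 2, 3})"
        using small_single_orbit[OF n' S(1)] by blast
      then show ?thesis
        using rename_vars_sigma[OF n0 S0] S(2) orbit_eq[OF f0] by auto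
    qed
    then show ?thesis
      using f g f0 orbit_sym orbit_trans by meson
  qed
  note to_orbit = this
  show ?thesis
  proof (intro equalityI subrelI)
    fix f g assume "(f, g) \<in> affine_equiv n"
    then show "(f, g) \<in> {(f, g). f \<in> cubic_mrs n \<and> g \<in> orbit (G n) (mrs_action n) f}"
      using to_orbit by (auto simp: affine_equiv_def)
  next
    fix f g assume "(f, g) \<in> {(f, g). f \<in> cubic_mrs n \<and> g \<in> orbit (G n) (mrs_action n) f}"
    then have f: "f \<in> cubic_mrs n" and "g \<in> orbit (G n) (mrs_action n) f"
      by simp_all
    then obtain \<tau> where \<tau>: "gcd \<tau> (int n) = 1" "g = rename_vars (sigma \<tau> n) f"
      unfolding orbit_eq[OF f] by (elim imageE CollectE) (rule that)
    then show "(f, g) \<in> affine_equiv n"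
      using f sigma_preserves_rotation_symmetry[OF n0 \<tau>(1)] sigma_cubic_mrs[OF n0 f \<tau>(1)]
      by (auto simp: affine_equiv_def intro!: exI[of _ "sigma \<tau> n"])
  qed
qed

theorem theorem3p8:
  fixes n :: nat
  assumes "n \<ge> 3"
  shows "group_action (G n) (cubic_mrs n) (mrs_action n) \<and>
    equiv (cubic_mrs n) (affine_equiv n) \<and>
    orbits (G n) (cubic_mrs n) (mrs_action n) = cubic_mrs n // affine_equiv n"
proof -
  have n0: "0 < n"
    using assms by simp
  show ?thesis
    using group_action_G[OF n0] group_action.equiv_orbit[OF group_action_G[OF n0]]
      group_action.orbits_quotient[OF group_action_G[OF n0]]
    by (simp add: affine_equiv_orbit[OF assms])
qed

end
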